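(* Let $X \ne \{0\}$ be a finite-dimensional real vector space, ordered by a closed cone $X_+$ with non-empty interior. Let $A \in \mathcal{L}(X)$ and assume that $(e^{tA})_{t\ge0}$ is weakly eventually nonnegative. Then: (a) the spectral bound $s(A)$ is an eigenvalue of $A$; (b) there exists an eigenvector $x \in X_+$ of $A$ for the eigenvalue $s(A)$; (c) there exists an eigenvector $x' \in X'_+$ of the dual operator $A'$ for the eigenvalue $s(A)$.
   Context: A cone is a non-empty subset $X_+\subseteq X$ with $X_+ + X_+\subseteq X_+$, $\lambda X_+\subseteq X_+$ for $\lambda\ge 0$, and $X_+\cap(-X_+)=\{0\}$. The dual cone is $X'_+ := \{x' \in X' : \langle x', x\rangle \ge 0\ \forall x\in X_+\}$. $(e^{tA})_{t\ge0}$ is weakly eventually nonnegative if for each $x\in X_+$ and each $x'\in X'_+$ there exists $t_0\ge0$ with $\langle x', e^{tA}x\rangle \ge 0$ for all $t\ge t_0$. The spectrum $\sigma(A)$ is the spectrum of the complex-linear extension of $A$ to the complexification of $X$, and $s(A) := \max\{\operatorname{Re}\lambda : \lambda\in\sigma(A)\}$. *)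

theory Defs
  imports "HOL-Analysis.Analysis"
begin

definition ord_cone :: "'a::real_vector set \<Rightarrow> bool" where
  "ord_cone C \<longleftrightarrow> C \<noteq> {} \<and> (\<forall>x\<in>C. \<forall>y\<in>C. x + y \<in> C)
     \<and> (\<forall>c::real. \<forall>x\<in>C. c \<ge> 0 \<longrightarrow> c *\<^sub>R x \<in> C)
     \<and> C \<inter> uminus ` C = {0}"

text \<open>Dual cone: nonnegative linear functionals on C (the dual space X' of a
finite-dimensional space consists of all linear functionals).\<close>
definition dual_cone :: "'a::real_vector set \<Rightarrow> ('a \<Rightarrow> real) set" where
  "dual_cone C = {f. linear f \<and> (\<forall>x\<in>C. 0 \<le> f x)}"

definition op_exp :: "real \<Rightarrow> ('a::real_normed_vector \<Rightarrow> 'a) \<Rightarrow> 'a \<Rightarrow> 'a" where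
  "op_exp t A x = (\<Sum>n. (t ^ n / fact n) *\<^sub>R (A ^^ n) x)"

definition weakly_eventually_nonneg ::
  "'a::real_normed_vector set \<Rightarrow> ('a \<Rightarrow> 'a) \<Rightarrow> bool" where
  "weakly_eventually_nonneg C A \<longleftrightarrow>
     (\<forall>x\<in>C. \<forall>f\<in>dual_cone C. \<exists>t0\<ge>0. \<forall>t\<ge>t0. 0 \<le> f (op_exp t A x))"

text \<open>Spectrum of the complexification of A. The complexification of X is modelled
as X \<times> X (pair (u,v) standing for u + i v); multiplication by \<lambda> = a + i b acts as
(u,v) \<mapsto> (a u - b v, b u + a v). \<lambda> is in the spectrum iff \<lambda> I - A_C is not bijective.\<close>
definition cspectrum :: "('a::real_vector \<Rightarrow> 'a) \<Rightarrow> complex set" where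
  "cspectrum A = {z. \<not> bij (\<lambda>(u, v). (Re z *\<^sub>R u - Im z *\<^sub>R v - A u,
                                        Im z *\<^sub>R u + Re z *\<^sub>R v - A v))}"

definition spectral_bound :: "('a::real_vector \<Rightarrow> 'a) \<Rightarrow> real" where
  "spectral_bound A = Max (Re ` cspectrum A)"

end

theory Submission
  imports Defs "HOL-Computational_Algebra.Fundamental_Theorem_Algebra"
begin

text \<open>
  Let \<open>s\<close> be the spectral bound and write \<open>R(\<lambda>)\<close> for the resolvent. For \<open>x\<close> in the cone and \<open>f\<close> in the
  dual cone the function \<open>f (e\<^bsup>tA\<^esup> x)\<close> is nonnegative for large \<open>t\<close>, so comparing Laplace integrals gives
  \<open>\<bar>f (R(c + i\<omega>) x)\<bar> \<le> f (R(c) x) + K\<close> for \<open>c > s\<close>, with \<open>K\<close> independent of \<open>c\<close> and \<open>\<omega>\<close>.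
  If \<open>s\<close> were not an eigenvalue, the right-hand side would stay bounded as \<open>c\<close> decreases to \<open>s\<close>,
  whereas the left-hand side blows up for suitable \<open>x\<close>, \<open>f\<close> if \<open>s + i\<omega>\<close> is an eigenvalue.
  Hence \<open>s\<close> is an eigenvalue, \<open>R(c) x\<close> is unbounded for some \<open>x\<close> in the cone, and, since
  \<open>f (R(c) x) \<ge> - K\<close>, every limit point of the normalised vectors \<open>R(c) x\<close> is an eigenvector in the cone.
  The same argument applied to the adjoint yields the dual eigenvector.
\<close>

section \<open>The operator exponential: convergence, intertwining, derivative\<close>

lemma op_exp_summable:
  fixes B :: "'b::euclidean_space \<Rightarrow> 'b"
  assumes "linear B"
  shows "summable (\<lambda>n. (t ^ n / fact n) *\<^sub>R (B ^^ n) z)"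
proof -
  obtain K where K: "K > 0" "\<And>x. norm (B x) \<le> norm x * K"
    using assms bounded_linear.pos_bounded linear_conv_bounded_linear by blast
  have pow: "norm ((B ^^ n) z) \<le> K ^ n * norm z" for n
  proof (induction n)
    case (Suc n)
    have "norm (B ((B ^^ n) z)) \<le> norm ((B ^^ n) z) * K" by (rule K)
    also have "\<dots> \<le> (K ^ n * norm z) * K" using Suc K(1) by (intro mult_right_mono) auto
    finally show ?case by (simp add: mult_ac)
  qed simp
  have "summable (\<lambda>n. ((\<bar>t\<bar> * K) ^ n /\<^sub>R fact n) * norm z)"
    by (intro summable_mult2 summable_exp_generic)
  then show ?thesis
  proof (rule summable_comparison_test'[where N = 0])
    fix n :: nat
    have "norm ((t ^ n / fact n) *\<^sub>R (B ^^ n) z) \<le> \<bar>t\<bar> ^ n / fact n * (K ^ n * norm z)"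
      by (auto simp: power_abs intro!: mult_left_mono divide_right_mono pow)
    then show "norm ((t ^ n / fact n) *\<^sub>R (B ^^ n) z) \<le> ((\<bar>t\<bar> * K) ^ n /\<^sub>R fact n) * norm z"
      by (simp add: power_mult_distrib field_simps)
  qed
qed

lemma op_exp_0 [simp]: "op_exp 0 B z = z"
proof -
  have "(\<lambda>n. ((0::real) ^ n / fact n) *\<^sub>R (B ^^ n) z) = (\<lambda>n. if n = 0 then z else 0)"
    by (auto simp: fun_eq_iff power_0_left)
  then show ?thesis
    unfolding op_exp_def using sums_single[of 0 "\<lambda>_. z"] by (simp add: sums_iff)
qed

lemma op_exp_add:
  fixes B :: "'b::euclidean_space \<Rightarrow> 'b"
  assumes "linear B"
  shows "op_exp t B (z + w) = op_exp t B z + op_exp t B w"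
proof -
  have "(B ^^ n) (z + w) = (B ^^ n) z + (B ^^ n) w" for n
    by (induction n) (simp_all add: linear_add[OF assms])
  then show ?thesis
    using suminf_add[OF op_exp_summable[OF assms, of t z] op_exp_summable[OF assms, of t w]]
    by (simp add: op_exp_def scaleR_add_right)
qed

text \<open>\<open>L\<close> carries powers of \<open>B\<close> to powers of \<open>A\<close> and,
  being continuous, passes through the series. Negation, complex scalars, the embedding of X into
  its complexification and the factors B - r are all handled as instances.\<close>

lemma op_exp_intertwine:
  fixes B :: "'b::euclidean_space \<Rightarrow> 'b" and A :: "'c::euclidean_space \<Rightarrow> 'c"
  assumes B: "linear B" and L: "linear L" and LB: "\<And>z. L (B z) = A (L z)"
  shows "L (op_exp t B z) = op_exp t A (L z)"
proof -
  have pow: "L ((B ^^ n) z) = (A ^^ n) (L z)" for n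
    by (induction n) (simp_all add: LB)
  have "bounded_linear L" using L by (simp add: linear_conv_bounded_linear)
  from bounded_linear.suminf[OF this op_exp_summable[OF B, of t z]]
  show ?thesis by (simp add: op_exp_def pow linear_scale[OF L])
qed

text \<open>Each coordinate is an everywhere convergent power series in t, so termwise
  differentiation applies; the shift of coefficients turns B^n z into B^n (B z).\<close>

lemma op_exp_has_vector_derivative:
  fixes B :: "'b::euclidean_space \<Rightarrow> 'b"
  assumes B: "linear B"
  shows "((\<lambda>t. op_exp t B z) has_vector_derivative op_exp t B (B z)) (at t)"
proof -
  have comp: "op_exp t B w \<bullet> b = (\<Sum>n. ((B ^^ n) w \<bullet> b / fact n) * t ^ n)" for t w b
    unfolding op_exp_def
    by (subst bounded_linear.suminf[OF bounded_linear_inner_left op_exp_summable[OF B]])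
       (simp add: field_simps)
  have sm: "summable (\<lambda>n. ((B ^^ n) z \<bullet> b / fact n) * y ^ n)" for b y
    using bounded_linear.summable[OF bounded_linear_inner_left[of b] op_exp_summable[OF B, of y z]]
    by (simp add: field_simps)
  have "((\<lambda>t. op_exp t B z \<bullet> b) has_field_derivative op_exp t B (B z) \<bullet> b) (at t)" for b
  proof -
    have "diffs (\<lambda>n. (B ^^ n) z \<bullet> b / fact n) = (\<lambda>n. (B ^^ n) (B z) \<bullet> b / fact n)"
      by (simp add: diffs_def fun_eq_iff funpow_Suc_right del: funpow.simps of_nat_Suc)
    then show ?thesis
      using termdiffs_strong_converges_everywhere[OF sm[of b], of t] by (simp add: comp)
  qed
  moreover have "(\<lambda>h. h *\<^sub>R v \<bullet> b) = (*) (v \<bullet> b)" for v b :: 'b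
    by (simp add: fun_eq_iff mult.commute)
  ultimately show ?thesis
    unfolding has_vector_derivative_def has_field_derivative_def
    by (subst has_derivative_componentwise_within) simp
qed

section \<open>Complex scalars on pairs, and the spectrum as a set of eigenvalues\<close>

text \<open>As in \<open>cspectrum\<close>, \<open>(u, v)\<close> stands for u + i v. The
  complexification thus stays a real Euclidean space, to which real linear algebra and real
  dimension apply.\<close>

definition cmul :: "complex \<Rightarrow> 'a::real_vector \<times> 'a \<Rightarrow> 'a \<times> 'a" where
  "cmul c z = (Re c *\<^sub>R fst z - Im c *\<^sub>R snd z, Im c *\<^sub>R fst z + Re c *\<^sub>R snd z)"

text \<open>On squaring, the mixed terms in u and v from the two components cancel.\<close>

lemma norm_cmul: "norm (cmul c z) = cmod c * norm (z :: 'a::real_inner \<times> 'a)"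
proof -
  obtain u v where z: "z = (u, v)" by fastforce
  have "(norm (cmul c z))\<^sup>2 = (cmod c * norm z)\<^sup>2"
    unfolding z cmul_def
    by (simp add: norm_Pair cmod_def power_mult_distrib)
       (simp only: power2_norm_eq_inner, simp add: inner_simps inner_commute algebra_simps power2_eq_square)
  then show ?thesis by (simp add: power2_eq_iff_nonneg)
qed

lemma cmul_simps:
  "cmul 1 z = z" "cmul 0 z = 0" "cmul c 0 = 0"
  "cmul c (cmul d z) = cmul (c * d) z"
  "cmul (of_real r) z = r *\<^sub>R z"
  by (simp_all add: cmul_def prod_eq_iff algebra_simps zero_prod_def)

lemma cmul_add:
  "cmul (c + d) z = cmul c z + cmul d z" "cmul c (z + w) = cmul c z + cmul c w"
  "cmul (c - d) z = cmul c z - cmul d z" "cmul c (z - w) = cmul c z - cmul c w"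
  "cmul (- c) z = - cmul c z"
  by (simp_all add: cmul_def prod_eq_iff algebra_simps)

lemma bounded_bilinear_cmul:
  "bounded_bilinear (cmul :: complex \<Rightarrow> 'a::real_inner \<times> 'a \<Rightarrow> _)"
proof
  show "\<exists>K. \<forall>a b. norm (cmul a (b :: 'a \<times> 'a)) \<le> norm a * norm b * K"
    by (intro exI[of _ 1]) (simp add: norm_cmul)
qed (simp_all add: cmul_def prod_eq_iff algebra_simps)

lemma cmul_linear: "linear (cmul c)"
  by (rule linearI) (simp_all add: cmul_def prod_eq_iff algebra_simps)

lemma cmul_eq_0_iff: "cmul c z = 0 \<longleftrightarrow> c = 0 \<or> z = (0 :: 'a::real_inner \<times> 'a)"
proof -
  have "norm (cmul c z) = 0 \<longleftrightarrow> cmod c = 0 \<or> norm z = 0" by (simp add: norm_cmul)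
  then show ?thesis by simp
qed

lemma linear_map_prod: "linear A \<Longrightarrow> linear (map_prod A A)"
  by (rule linearI) (simp_all add: prod_eq_iff linear_add linear_scale)

lemma map_prod_cmul: "linear A \<Longrightarrow> map_prod A A (cmul c z) = cmul c (map_prod A A z)"
  by (simp add: cmul_def prod_eq_iff linear_add linear_diff linear_scale)

text \<open>In finite dimension injectivity already gives bijectivity, so only the kernel
  matters.\<close>

lemma mem_cspectrum_iff:
  fixes A :: "'a::euclidean_space \<Rightarrow> 'a"
  assumes "linear A"
  shows "l \<in> cspectrum A \<longleftrightarrow> (\<exists>z. z \<noteq> 0 \<and> map_prod A A z = cmul l z)"
proof -
  let ?T = "\<lambda>z. cmul l z - map_prod A A z"
  have eq: "(\<lambda>(u, v). (Re l *\<^sub>R u - Im l *\<^sub>R v - A u, Im l *\<^sub>R u + Re l *\<^sub>R v - A v)) = ?T"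
    by (auto simp: cmul_def fun_eq_iff)
  have lin: "linear ?T"
    using linear_compose_sub[OF cmul_linear linear_map_prod[OF assms]] .
  have "bij ?T \<longleftrightarrow> inj ?T"
    using linear_injective_imp_surjective[OF lin] by (auto simp: bij_def)
  also have "\<dots> \<longleftrightarrow> (\<forall>z. map_prod A A z = cmul l z \<longrightarrow> z = 0)"
    unfolding linear_injective_0[OF lin] right_minus_eq by (simp only: eq_commute)
  finally show ?thesis unfolding cspectrum_def mem_Collect_eq eq by blast
qed

section \<open>Annihilating products of linear factors; the spectrum is finite and non-empty\<close>

text \<open>This is p(B) z for the complexified operator B = \<open>map_prod A A\<close>, evaluated
  by Horner's scheme.\<close>

definition poly_act :: "('a \<Rightarrow> 'a) \<Rightarrow> complex poly \<Rightarrow> 'a::real_vector \<times> 'a \<Rightarrow> 'a \<times> 'a" where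
  "poly_act A p z = fold_coeffs (\<lambda>c w. cmul c z + map_prod A A w) p 0"

text \<open>The product of the operators B - r over the list, with the head acting first.\<close>

fun linear_factors :: "('a::real_vector \<Rightarrow> 'a) \<Rightarrow> complex list \<Rightarrow> 'a \<times> 'a \<Rightarrow> 'a \<times> 'a" where
  "linear_factors A [] z = z"
| "linear_factors A (r # rs) z = linear_factors A rs (map_prod A A z - cmul r z)"

text \<open>The iterates up to index \<open>DIM('b)\<close> are one more than the dimension.
  Repeated iterates are treated separately, because dependence is a property of sets and a
  repetition would shrink the set.\<close>

lemma powers_dependent:
  fixes B :: "'b::euclidean_space \<Rightarrow> 'b"
  shows "\<exists>a::nat \<Rightarrow> real. (\<exists>i\<le>DIM('b). a i \<noteq> 0) \<and> (\<Sum>i\<le>DIM('b). a i *\<^sub>R (B ^^ i) z) = 0"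
proof (cases "inj_on (\<lambda>i. (B ^^ i) z) {..DIM('b)}")
  case True
  let ?S = "(\<lambda>i. (B ^^ i) z) ` {..DIM('b)}"
  have "card ?S = Suc (DIM('b))" using True by (simp add: card_image)
  then have "dependent ?S"
    using independent_bound by (metis not_less_eq_eq order_refl)
  then obtain u where u: "\<exists>v\<in>?S. u v \<noteq> 0" "(\<Sum>v\<in>?S. u v *\<^sub>R v) = 0"
    by (auto simp: dependent_finite)
  then show ?thesis
    by (intro exI[of _ "\<lambda>i. u ((B ^^ i) z)"]) (auto simp: sum.reindex[OF True])
next
  case False
  then obtain i j where ij: "i \<le> DIM('b)" "j \<le> DIM('b)" "i \<noteq> j" "(B ^^ i) z = (B ^^ j) z"
    by (auto simp: inj_on_def)
  let ?a = "\<lambda>k. (if k = i then 1 else 0) - (if k = j then 1 else 0) :: real"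
  have "(\<Sum>k\<le>DIM('b). ?a k *\<^sub>R (B ^^ k) z) = 0"
    using ij by (simp add: algebra_simps sum_subtractf if_distrib[of "\<lambda>c. c *\<^sub>R _"] sum.delta
        cong: if_cong)
  moreover have "?a i \<noteq> 0" using ij by simp
  ultimately show ?thesis using ij(1) by (intro exI[of _ ?a] conjI exI[of _ i])
qed

context
  fixes A :: "'a::euclidean_space \<Rightarrow> 'a"
  assumes A: "linear A"
begin

lemma poly_act_0: "poly_act A 0 z = 0"
  by (simp add: poly_act_def)

lemma poly_act_pCons: "poly_act A (pCons c p) z = cmul c z + map_prod A A (poly_act A p z)"
  by (cases "p = 0 \<and> c = 0")
     (auto simp: poly_act_def cmul_simps linear_0[OF linear_map_prod[OF A], unfolded zero_prod_def]
        linear_0[OF A] zero_prod_def)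

lemma poly_act_add: "poly_act A (p + q) z = poly_act A p z + poly_act A q z"
  by (induction p q rule: poly_induct2)
     (simp_all add: poly_act_0 poly_act_pCons cmul_add linear_add[OF linear_map_prod[OF A]])

lemma poly_act_smult: "poly_act A (smult c p) z = cmul c (poly_act A p z)"
  by (induction p) (simp_all add: poly_act_0 poly_act_pCons cmul_simps cmul_add map_prod_cmul[OF A])

lemma poly_act_monom: "poly_act A (monom c n) z = cmul c ((map_prod A A ^^ n) z)"
  by (induction n)
     (simp_all add: monom_0 monom_Suc poly_act_0 poly_act_pCons cmul_simps
        linear_0[OF linear_map_prod[OF A]] map_prod_cmul[OF A])

lemma poly_act_sum: "poly_act A (\<Sum>i\<in>I. p i) z = (\<Sum>i\<in>I. poly_act A (p i) z)"
  by (induction I rule: infinite_finite_induct) (simp_all add: poly_act_0 poly_act_add)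

text \<open>Splitting off a root lets its factor act on the vector first, which is the recursion of
  \<open>linear_factors\<close>. The induction rests on (X - r)(c + X p) = c (X - r) + X ((X - r)
  p).\<close>

lemma poly_act_linear_factor:
  "poly_act A ([:-r, 1:] * p) z = poly_act A p (map_prod A A z - cmul r z)"
proof (induction p)
  case (pCons c p)
  have "[:-r, 1:] * pCons c p = smult c [:-r, 1:] + pCons 0 ([:-r, 1:] * p)"
    by (simp add: algebra_simps)
  then have "poly_act A ([:-r, 1:] * pCons c p) z =
      cmul c (poly_act A [:-r, 1:] z) + map_prod A A (poly_act A ([:-r, 1:] * p) z)"
    by (simp only: poly_act_add poly_act_smult poly_act_pCons[of 0 "[:-r, 1:] * p"] cmul_simps add_0)
  also have "poly_act A [:-r, 1:] z = map_prod A A z - cmul r z"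
    by (simp add: poly_act_0 poly_act_pCons cmul_simps cmul_add linear_0[OF linear_map_prod[OF A]])
  finally show ?case unfolding pCons.IH by (simp add: poly_act_pCons)
qed (simp add: poly_act_0)

lemma linear_factors_append:
  "linear_factors A (rs @ qs) z = linear_factors A qs (linear_factors A rs z)"
  by (induction rs arbitrary: z) auto

lemma linear_linear_factors: "linear (linear_factors A rs)"
proof (induction rs)
  case (Cons r rs)
  have "linear (\<lambda>z. map_prod A A z - cmul r z)"
    by (intro linear_compose_sub linear_map_prod A cmul_linear)
  from linear_compose[OF this Cons] show ?case by (simp add: o_def)
qed (simp add: linear_iff)

lemma linear_factors_commute:
  "linear_factors A rs (map_prod A A z - cmul r z)
    = map_prod A A (linear_factors A rs z) - cmul r (linear_factors A rs z)"
proof (induction rs arbitrary: z)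
  case (Cons q rs)
  have "map_prod A A (map_prod A A z - cmul r z) - cmul q (map_prod A A z - cmul r z)
      = map_prod A A (map_prod A A z - cmul q z) - cmul r (map_prod A A z - cmul q z)"
    by (simp add: linear_diff[OF linear_map_prod[OF A]] map_prod_cmul[OF A] cmul_add cmul_simps
        mult.commute)
  then show ?case by (simp add: Cons.IH)
qed simp

lemma linear_factors_swap:
  "linear_factors A rs (linear_factors A qs z) = linear_factors A qs (linear_factors A rs z)"
  by (induction rs arbitrary: z) (simp_all add: linear_factors_commute)

lemma linear_factors_of_annihilator:
  assumes "p \<noteq> 0" "poly_act A p z = 0"
  shows "\<exists>rs. linear_factors A rs z = 0"
  using assms
proof (induction "degree p" arbitrary: p z)
  case 0
  then obtain c where c: "p = [:c:]" "c \<noteq> 0"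
    by (metis degree_eq_zeroE pCons_0_0)
  with 0 have "z = 0"
    by (simp add: poly_act_0 poly_act_pCons linear_0[OF linear_map_prod[OF A]] cmul_eq_0_iff)
  then show ?case by (intro exI[of _ "[]"]) simp
next
  case (Suc n)
  have "\<not> constant (poly p)"
    using Suc.hyps(2) constant_degree[of p] by simp
  then obtain r where "poly p r = 0"
    using fundamental_theorem_of_algebra by blast
  then obtain q where q: "p = [:-r, 1:] * q"
    by (metis dvdE poly_eq_0_iff_dvd)
  have "q \<noteq> 0" using q Suc.prems by auto
  then have "degree p = Suc (degree q)"
    unfolding q by (subst degree_mult_eq) auto
  with Suc.hyps(2) have "n = degree q" by simp
  moreover have "poly_act A q (map_prod A A z - cmul r z) = 0"
    using Suc.prems(2) unfolding q poly_act_linear_factor .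
  ultimately obtain rs where "linear_factors A rs (map_prod A A z - cmul r z) = 0"
    using Suc.hyps(1) \<open>q \<noteq> 0\<close> by blast
  then show ?case by (intro exI[of _ "r # rs"]) simp
qed

text \<open>A linear dependence among the iterates of \<open>z\<close> is an annihilating polynomial
  with real coefficients.\<close>

lemma linear_factors_exists: "\<exists>rs. linear_factors A rs z = 0"
proof -
  let ?N = "DIM('a \<times> 'a)"
  obtain a i where a: "i \<le> ?N" "a i \<noteq> 0" "(\<Sum>i\<le>?N. a i *\<^sub>R (map_prod A A ^^ i) z) = 0"
    using powers_dependent[of "map_prod A A" z] by blast
  define p where "p = (\<Sum>i\<le>?N. monom (complex_of_real (a i)) i)"
  have "coeff p i = of_real (a i)"
    using a(1) by (simp add: p_def coeff_sum)
  with a(2) have "p \<noteq> 0" by auto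
  moreover have "poly_act A p z = 0"
    using a(3) by (simp add: p_def poly_act_sum poly_act_monom cmul_simps)
  ultimately show ?thesis by (rule linear_factors_of_annihilator)
qed

text \<open>Lists for the individual basis vectors are concatenated; as the factors commute, each
  vector is still killed. The result plays the part of an annihilating polynomial of the whole
  operator.\<close>

lemma linear_factors_annihilate_all: "\<exists>rs. \<forall>z. linear_factors A rs z = 0"
proof -
  have "\<exists>rs. \<forall>z\<in>S. linear_factors A rs z = 0" if "finite S" for S
    using that
  proof induction
    case (insert x S)
    then obtain rs qs where "\<forall>z\<in>S. linear_factors A rs z = 0" "linear_factors A qs x = 0"
      using linear_factors_exists by blast
    then have "linear_factors A (rs @ qs) z = 0" if "z \<in> insert x S" for z
      using that unfolding linear_factors_append
      by (metis insertE linear_0 linear_linear_factors linear_factors_swap)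
    then show ?case by blast
  qed simp
  from this[OF finite_Basis] obtain rs where rs: "\<forall>z\<in>Basis. linear_factors A rs z = 0" by blast
  have "linear_factors A rs z = 0" for z
    using linear_eq_stdbasis[OF linear_linear_factors linear_zero, of rs] rs by auto
  then show ?thesis by blast
qed

text \<open>On an eigenvector for \<open>l\<close> the factor B - q acts as the scalar l - q, so a
  vanishing product forces \<open>l\<close> to be one of the \<open>q\<close>.\<close>

lemma finite_cspectrum: "finite (cspectrum A)"
proof -
  obtain rs where rs: "\<And>z. linear_factors A rs z = 0" using linear_factors_annihilate_all by blast
  have ev: "l \<in> set qs"
    if "map_prod A A z = cmul l z" "z \<noteq> 0" "linear_factors A qs z = 0" for l z qs
    using that
  proof (induction qs arbitrary: z)
    case (Cons q qs)
    show ?case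
    proof (cases "l = q")
      case False
      have "map_prod A A z - cmul q z = cmul (l - q) z" using Cons.prems by (simp add: cmul_add)
      with Cons False show ?thesis
        using Cons.IH[of "cmul (l - q) z"]
        by (simp add: cmul_eq_0_iff map_prod_cmul[OF A] cmul_simps mult.commute)
    qed simp
  qed simp
  have "cspectrum A \<subseteq> set rs"
    using ev rs by (auto simp: mem_cspectrum_iff[OF A])
  then show ?thesis by (rule finite_subset) simp
qed

text \<open>With empty spectrum every factor is injective, and an annihilating product would force
  every vector to be zero.\<close>

lemma cspectrum_nonempty: "cspectrum A \<noteq> {}"
proof
  assume empty: "cspectrum A = {}"
  have "z = 0" if "linear_factors A rs z = 0" for rs z
    using that
  proof (induction rs arbitrary: z)
    case (Cons r rs)
    then have "map_prod A A z = cmul r z" by fastforce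
    then show ?case using empty mem_cspectrum_iff[OF A, of r] by blast
  qed simp
  then have "z = 0" for z :: "'a \<times> 'a" using linear_factors_exists by blast
  from this[of "(SOME b. b \<in> Basis, 0)"] show False
    by (metis SOME_Basis nonzero_Basis prod.inject zero_prod_def)
qed

section \<open>Orbits on the complexification: growth and comparison of resolvents\<close>

lemma op_exp_cmul: "op_exp t (map_prod A A) (cmul r z) = cmul r (op_exp t (map_prod A A) z)"
  using op_exp_intertwine[OF linear_map_prod[OF A] cmul_linear] map_prod_cmul[OF A] by metis

lemma op_exp_real_vector: "op_exp t (map_prod A A) (x, 0) = (op_exp t A x, 0)"
proof -
  have "linear (\<lambda>x. (x, 0 :: 'a))" by (rule linearI) auto
  from op_exp_intertwine[OF A this, of "map_prod A A"] show ?thesis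
    by (simp add: linear_0[OF A])
qed

text \<open>The product rule moves the derivative into the starting vector. With -l for
  \<open>r\<close> and the resolvent of a vector for \<open>z\<close>, the new starting vector is
  minus that vector, so resolvents become primitives of scaled orbits.\<close>

lemma scaled_orbit_derivative:
  "((\<lambda>t. cmul (exp (t *\<^sub>R r)) (op_exp t (map_prod A A) z)) has_vector_derivative
    cmul (exp (t *\<^sub>R r)) (op_exp t (map_prod A A) (map_prod A A z + cmul r z))) (at t)"
proof -
  have "((\<lambda>t. cmul (exp (t *\<^sub>R r)) (op_exp t (map_prod A A) z)) has_vector_derivative
    (cmul (exp (t *\<^sub>R r)) (op_exp t (map_prod A A) (map_prod A A z))
      + cmul (exp (t *\<^sub>R r) * r) (op_exp t (map_prod A A) z))) (at t)"
    by (rule bounded_bilinear.has_vector_derivative[OF bounded_bilinear_cmul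
          exp_scaleR_has_vector_derivative_right
          op_exp_has_vector_derivative[OF linear_map_prod[OF A]]])
  then show ?thesis
    by (simp add: op_exp_add[OF linear_map_prod[OF A]] op_exp_cmul cmul_add cmul_simps)
qed

lemma Re_le_spectral_bound: "l \<in> cspectrum A \<Longrightarrow> Re l \<le> spectral_bound A"
  unfolding spectral_bound_def using finite_cspectrum by (intro Max_ge) auto

lemma spectral_bound_attained: "\<exists>l\<in>cspectrum A. Re l = spectral_bound A"
proof -
  have "spectral_bound A \<in> Re ` cspectrum A"
    unfolding spectral_bound_def
    using finite_cspectrum cspectrum_nonempty by (intro Max_in) auto
  then show ?thesis by auto
qed

text \<open>
  Remove one factor \<open>B - r\<close> of an annihilating product at a time: if \<open>r\<close> is not in the spectrum,
  the factor is bounded below; otherwise \<open>Re r < c\<close> and the derivative of \<open>e\<^bsup>-rt\<^esup> e\<^bsup>tB\<^esup> z\<close> is controlled.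
\<close>
lemma op_exp_growth_bound:
  assumes c: "spectral_bound A < c"
  shows "\<exists>M. \<forall>t\<ge>0. norm (op_exp t (map_prod A A) z) \<le> M * exp (c * t)"
proof -
  let ?B = "map_prod A A"
  have "\<exists>M. \<forall>t\<ge>0. norm (op_exp t ?B z) \<le> M * exp (c * t)"
    if "linear_factors A rs z = 0" for rs z
    using that
  proof (induction rs arbitrary: z)
    case Nil
    have "op_exp t ?B 0 = 0" for t using op_exp_cmul[of t 0 0] by (simp add: cmul_simps)
    with Nil show ?case by (intro exI[of _ 0]) simp
  next
    case (Cons r rs)
    define w where "w = ?B z + cmul (- r) z"
    have w_diff: "w = ?B z - cmul r z" by (simp add: w_def cmul_add)
    then have "linear_factors A rs w = 0"
      using Cons.prems by simp
    then obtain M where M: "\<And>t. t \<ge> 0 \<Longrightarrow> norm (op_exp t ?B w) \<le> M * exp (c * t)"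
      using Cons.IH by blast
    have "M \<ge> 0" using order_trans[OF norm_ge_zero M[of 0]] by simp
    show ?case
    proof (cases "r \<in> cspectrum A")
      case False
      let ?T = "\<lambda>z. ?B z - cmul r z"
      have lin: "linear ?T"
        by (intro linear_compose_sub linear_map_prod A cmul_linear)
      moreover have "inj ?T"
        unfolding linear_injective_0[OF lin] using False mem_cspectrum_iff[OF A] by auto
      ultimately obtain d where d: "d > 0" "\<And>x. d * norm x \<le> norm (?T x)"
        by (rule linear_inj_bounded_below_pos) blast
      have "norm (op_exp t ?B z) \<le> M / d * exp (c * t)" if "t \<ge> 0" for t
      proof -
        have "?T (op_exp t ?B z) = op_exp t ?B w"
          unfolding w_diff
          by (rule op_exp_intertwine[OF linear_map_prod[OF A] lin])
            (simp add: linear_diff[OF linear_map_prod[OF A]] map_prod_cmul[OF A])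
        then have "d * norm (op_exp t ?B z) \<le> M * exp (c * t)"
          using d(2)[of "op_exp t ?B z"] M[OF that] by (simp only:)
        then show ?thesis using d(1) by (simp add: field_simps)
      qed
      then show ?thesis by blast
    next
      case True
      \<comment> \<open>The gap \<open>d\<close> is positive for a spectral \<open>r\<close>; hence
        M/d e^(ds) is an increasing primitive of M e^(ds) and absorbs the constant
        \<open>norm z\<close> as well.\<close>
      define d where "d = c - Re r"
      have "d > 0" using Re_le_spectral_bound[OF True] c by (simp add: d_def)
      let ?F = "\<lambda>t. cmul (exp (t *\<^sub>R (- r))) (op_exp t ?B z)"
      let ?F' = "\<lambda>t. cmul (exp (t *\<^sub>R (- r))) (op_exp t ?B w)"
      have F': "(?F has_vector_derivative ?F' t) (at t)" for t
        unfolding w_def by (rule scaled_orbit_derivative)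
      have phi': "((\<lambda>t. M / d * exp (d * t)) has_vector_derivative M * exp (d * t)) (at t)" for t
        unfolding has_real_derivative_iff_has_vector_derivative[symmetric]
        using \<open>d > 0\<close> by (auto intro!: derivative_eq_intros)
      have "norm (op_exp t ?B z) \<le> (norm z + M / d) * exp (c * t)" if "t \<ge> 0" for t
      proof (cases "t = 0")
        case True
        then show ?thesis using \<open>M \<ge> 0\<close> \<open>d > 0\<close> by simp
      next
        case False
        \<comment> \<open>The mean value inequality takes the place of integrating the derivative
          bound.\<close>
        have "norm (?F t - ?F 0) \<le> M / d * exp (d * t) - M / d * exp (d * 0)"
        proof (rule differentiable_bound_general[where f' = ?F' and \<phi>' = "\<lambda>t. M * exp (d * t)"])
          show "0 < t" using that False by simp
          show "continuous_on {0..t} ?F"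
            by (intro continuous_at_imp_continuous_on ballI has_vector_derivative_continuous[OF F'])
          show "continuous_on {0..t} (\<lambda>t. M / d * exp (d * t))"
            by (intro continuous_intros)
          fix s :: real assume "0 < s"
          then have "norm (?F' s) \<le> exp (- (s * Re r)) * (M * exp (c * s))"
            using M[of s] by (simp add: norm_cmul norm_exp_eq_Re)
          also have "\<dots> = M * exp (d * s)"
            by (simp add: d_def exp_add[symmetric] algebra_simps)
          finally show "norm (?F' s) \<le> M * exp (d * s)" .
        qed (rule F' phi')+
        then have "norm (?F t) \<le> norm z + M / d * exp (d * t)"
          using norm_triangle_sub[of "?F t" "?F 0"] \<open>M \<ge> 0\<close> \<open>d > 0\<close>
          by (simp add: cmul_simps) (smt (verit) divide_nonneg_pos)
        also have "\<dots> \<le> norm z * exp (d * t) + M / d * exp (d * t)"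
          using \<open>d > 0\<close> that mult_left_mono[of 1 "exp (d * t)" "norm z"] by simp
        finally have F_le: "norm (?F t) \<le> (norm z + M / d) * exp (d * t)"
          by (simp add: distrib_right)
        have "norm (op_exp t ?B z) = exp (t * Re r) * norm (?F t)"
          by (simp add: norm_cmul norm_exp_eq_Re mult.assoc[symmetric] exp_add[symmetric])
        also have "\<dots> \<le> exp (t * Re r) * ((norm z + M / d) * exp (d * t))"
          by (intro mult_left_mono F_le) simp
        also have "\<dots> = (norm z + M / d) * (exp (t * Re r) * exp (d * t))"
          by (simp only: mult_ac)
        also have "exp (t * Re r) * exp (d * t) = exp (c * t)"
          by (simp add: d_def exp_add[symmetric] algebra_simps)
        finally show ?thesis .
      qed
      then show ?thesis by blast
    qed
  qed
  then show ?thesis using linear_factors_exists by blast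
qed

text \<open>A growth exponent chosen strictly between the spectral bound and \<open>Re l\<close>
  leaves an exponentially decaying factor.\<close>

lemma scaled_orbit_tendsto_0:
  assumes "spectral_bound A < Re l"
  shows "((\<lambda>t. cmul (exp (t *\<^sub>R (- l))) (op_exp t (map_prod A A) z)) \<longlongrightarrow> 0) at_top"
proof -
  obtain c where c: "spectral_bound A < c" "c < Re l" using dense[OF assms] by blast
  obtain M where M: "\<And>t. t \<ge> 0 \<Longrightarrow> norm (op_exp t (map_prod A A) z) \<le> M * exp (c * t)"
    using op_exp_growth_bound[OF c(1)] by blast
  have "((\<lambda>t. M * exp ((c - Re l) * t)) \<longlongrightarrow> M * 0) at_top"
  proof (intro tendsto_intros filterlim_compose[OF exp_at_bot])
    show "filterlim (\<lambda>t. (c - Re l) * t) at_bot at_top"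
      using c by (intro filterlim_tendsto_neg_mult_at_bot[OF tendsto_const _ filterlim_ident]) auto
  qed
  then have lim: "((\<lambda>t. M * exp ((c - Re l) * t)) \<longlongrightarrow> 0) at_top" by simp
  show ?thesis
  proof (rule Lim_null_comparison[OF _ lim])
    show "\<forall>\<^sub>F t in at_top. norm (cmul (exp (t *\<^sub>R (- l))) (op_exp t (map_prod A A) z))
        \<le> M * exp ((c - Re l) * t)"
      using eventually_ge_at_top[of 0]
    proof eventually_elim
      case (elim t)
      have "norm (cmul (exp (t *\<^sub>R (- l))) (op_exp t (map_prod A A) z))
          \<le> exp (- (t * Re l)) * (M * exp (c * t))"
        using M[OF elim] by (simp add: norm_cmul norm_exp_eq_Re)
      also have "\<dots> = M * exp ((c - Re l) * t)"
        by (simp add: exp_add[symmetric] algebra_simps)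
      finally show ?case .
    qed
  qed
qed

text \<open>
  Instead of improper Laplace integrals the proof compares the derivatives of \<open>e\<^bsup>-lt\<^esup> e\<^bsup>tB\<^esup> z\<close> and
  \<open>e\<^bsup>-t Re l\<^esup> e\<^bsup>tA\<^esup> u\<close>; both tend to \<open>0\<close>, and from \<open>t0\<close> on the second dominates the first.
\<close>
lemma resolvent_domination:
  assumes l: "spectral_bound A < Re l"
    and f: "linear f" and h: "linear h" "\<And>c v. \<bar>h (cmul c (v, 0))\<bar> \<le> cmod c * \<bar>f v\<bar>"
    and t0: "t0 \<ge> 0" "\<And>t. t \<ge> t0 \<Longrightarrow> 0 \<le> f (op_exp t A x)"
    and K: "\<And>t. 0 \<le> t \<Longrightarrow> t \<le> t0 \<Longrightarrow> exp (- (t * Re l)) * \<bar>f (op_exp t A x)\<bar> \<le> K"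
    and z: "cmul l z - map_prod A A z = (x, 0)"
    and u: "Re l *\<^sub>R u - A u = x"
  shows "\<bar>h z\<bar> \<le> f u + 2 * K * t0"
proof -
  let ?B = "map_prod A A"
  let ?F = "\<lambda>t. h (cmul (exp (t *\<^sub>R (- l))) (op_exp t ?B z))"
  let ?F' = "\<lambda>t. h (cmul (exp (t *\<^sub>R (- l))) (op_exp t ?B (- x, 0)))"
  let ?k = "complex_of_real (Re l)"
  let ?G = "\<lambda>t. f (fst (cmul (exp (t *\<^sub>R (- ?k))) (op_exp t ?B (u, 0))))"
  let ?g = "\<lambda>t. exp (- (t * Re l)) * f (op_exp t A x)"
  have "linear (\<lambda>z :: 'a \<times> 'a. f (fst z))"
    by (rule linearI) (simp_all add: linear_add[OF f] linear_scale[OF f])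
  then have bh: "bounded_linear h" and bf: "bounded_linear (\<lambda>z :: 'a \<times> 'a. f (fst z))"
    using h(1) by (simp_all add: linear_conv_bounded_linear)
  have op_minus: "op_exp t A (- x) = - op_exp t A x" for t
    by (rule op_exp_intertwine[OF A, symmetric, where L = uminus])
       (auto intro: linearI simp: linear_neg[OF A])
  have "?B z + cmul (- l) z = (- x, 0)"
    using z by (simp add: cmul_add prod_eq_iff algebra_simps)
  then have F': "(?F has_vector_derivative ?F' t) (at t)" for t
    using bounded_linear.has_vector_derivative[OF bh scaled_orbit_derivative[of "- l" z t]]
    by simp
  have "?B (u, 0) + cmul (- ?k) (u, 0) = (- x, 0)"
    using u by (simp add: cmul_def linear_0[OF A] algebra_simps)
  moreover have "f (fst (cmul (exp (t *\<^sub>R (- ?k))) (op_exp t ?B (- x, 0)))) = - ?g t" for t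
  proof -
    have "exp (t *\<^sub>R (- ?k)) = complex_of_real (exp (- (t * Re l)))"
      by (simp add: exp_of_real[symmetric] scaleR_conv_of_real)
    then show ?thesis
      by (simp add: op_exp_real_vector cmul_simps op_minus linear_scale[OF f] linear_neg[OF f])
  qed
  ultimately have G': "(?G has_vector_derivative - ?g t) (at t)" for t
    using bounded_linear.has_vector_derivative[OF bf scaled_orbit_derivative[of "- ?k" "(u, 0)" t]]
    by simp
  have F'_le: "\<bar>?F' t\<bar> \<le> exp (- (t * Re l)) * \<bar>f (op_exp t A x)\<bar>" for t
    using h(2)[of "exp (t *\<^sub>R (- l))" "- op_exp t A x"]
    by (simp add: op_exp_real_vector op_minus norm_exp_eq_Re linear_neg[OF f])
  have contF: "continuous_on S ?F" and contG: "continuous_on S ?G" for S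
    by (intro continuous_at_imp_continuous_on ballI
        has_vector_derivative_continuous[OF F'] has_vector_derivative_continuous[OF G'])+
  \<comment> \<open>A mean value inequality that also covers the degenerate interval, needed when
    \<open>t0\<close> is 0 or t equals \<open>t0\<close>.\<close>
  have bound: "norm (p b - p a) \<le> q b - q a"
    if "a \<le> b" "continuous_on {a..b} p" "continuous_on {a..b} q"
      "\<And>t. (p has_vector_derivative p' t) (at t)" "\<And>t. (q has_vector_derivative q' t) (at t)"
      "\<And>t. a \<le> t \<Longrightarrow> t \<le> b \<Longrightarrow> norm (p' t) \<le> q' t"
    for a b :: real and p p' q q' :: "real \<Rightarrow> real"
  proof (cases "a = b")
    case False
    with that show ?thesis
      by (intro differentiable_bound_general[where f' = p' and \<phi>' = q']) auto
  qed simp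
  have lin': "((\<lambda>t. K * t) has_vector_derivative K) (at t)" for t
    unfolding has_real_derivative_iff_has_vector_derivative[symmetric]
    by (auto intro!: derivative_eq_intros)
  have F'_K: "norm (?F' t) \<le> K" if "0 \<le> t" "t \<le> t0" for t
    using order_trans[OF F'_le K[OF that]] by simp
  \<comment> \<open>Before \<open>t0\<close> there is no sign information; \<open>?F\<close> and
    \<open>?G\<close> each change by at most K t0 there, which accounts for the term 2 K t0.\<close>
  have "norm (?F t0 - ?F 0) \<le> K * t0 - K * 0"
    by (rule bound[OF t0(1) contF _ F' lin'])
       (use F'_K in \<open>auto intro!: continuous_intros\<close>)
  moreover have "norm (?G t0 - ?G 0) \<le> K * t0 - K * 0"
    by (rule bound[OF t0(1) contG _ G' lin']) (use K in \<open>auto intro!: continuous_intros simp: abs_mult\<close>)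
  \<comment> \<open>After \<open>t0\<close> the nonnegative \<open>?g\<close> dominates the
    derivative of \<open>?F\<close> and is minus that of \<open>?G\<close>. Letting t grow, where
    both functions vanish in the limit, gives the claim.\<close>
  moreover have "\<bar>?F t0\<bar> \<le> ?G t0"
  proof (rule tendsto_le[OF trivial_limit_at_top_linorder])
    have "(?F \<longlongrightarrow> h 0) at_top"
      by (intro bounded_linear.tendsto[OF bh] scaled_orbit_tendsto_0 l)
    then show "((\<lambda>t. \<bar>?F t - ?F t0\<bar>) \<longlongrightarrow> \<bar>?F t0\<bar>) at_top"
      using linear_0[OF h(1)] by (auto intro!: tendsto_eq_intros)
    have "(?G \<longlongrightarrow> f (fst (0 :: 'a \<times> 'a))) at_top"
      by (intro bounded_linear.tendsto[OF bf] scaled_orbit_tendsto_0) (simp add: l)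
    then show "((\<lambda>t. ?G t0 - ?G t) \<longlongrightarrow> ?G t0) at_top"
      using linear_0[OF f] by (auto intro!: tendsto_eq_intros)
    show "\<forall>\<^sub>F t in at_top. \<bar>?F t - ?F t0\<bar> \<le> ?G t0 - ?G t"
      using eventually_ge_at_top[of t0]
    proof eventually_elim
      case (elim t)
      have "norm (?F t - ?F t0) \<le> (- ?G t) - (- ?G t0)"
      proof (rule bound[OF elim contF _ F'])
        show "continuous_on {t0..t} (\<lambda>t. - ?G t)"
          by (intro continuous_on_minus contG)
        show "((\<lambda>t. - ?G t) has_vector_derivative - (- ?g s)) (at s)" for s
          by (rule has_vector_derivative_minus[OF G'])
        show "norm (?F' s) \<le> - (- ?g s)" if "t0 \<le> s" for s
          using F'_le[of s] t0(2)[OF that] by simp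
      qed
      then show ?case by simp
    qed
  qed
  moreover have "?F 0 = h z" "?G 0 = f u"
    by (simp_all add: cmul_simps)
  ultimately show ?thesis by (simp add: abs_le_iff)
qed

end

section \<open>Closed cones and their duals\<close>

lemma zero_in_ord_cone: "ord_cone C \<Longrightarrow> 0 \<in> C"
  unfolding ord_cone_def by blast

lemma ord_cone_antisym: "ord_cone C \<Longrightarrow> x \<in> C \<Longrightarrow> - x \<in> C \<Longrightarrow> x = 0"
  unfolding ord_cone_def by (metis IntI image_eqI minus_minus singletonD)

lemma convex_ord_cone: "ord_cone C \<Longrightarrow> convex C"
  unfolding ord_cone_def convex_def by simp

text \<open>The bipolar theorem: a hyperplane separating \<open>x\<close> from the cone has a normal
  vector that is nonnegative on the cone.\<close>

lemma mem_ord_cone_iff_dual: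
  fixes C :: "'a::euclidean_space set"
  assumes C: "ord_cone C" "closed C"
  shows "x \<in> C \<longleftrightarrow> (\<forall>f\<in>dual_cone C. 0 \<le> f x)"
proof
  assume dual: "\<forall>f\<in>dual_cone C. 0 \<le> f x"
  show "x \<in> C"
  proof (rule ccontr)
    assume "x \<notin> C"
    then obtain a b where ab: "a \<bullet> x < b" "\<And>y. y \<in> C \<Longrightarrow> b < a \<bullet> y"
      using separating_hyperplane_closed_point[OF convex_ord_cone[OF C(1)] C(2)] by blast
    have "b < 0" using ab(2)[OF zero_in_ord_cone[OF C(1)]] by simp
    have "0 \<le> a \<bullet> y" if "y \<in> C" for y
    proof (rule ccontr)
      assume neg: "\<not> 0 \<le> a \<bullet> y"
      \<comment> \<open>This multiple has inner product exactly \<open>b\<close> with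
        \<open>a\<close>, against the strict separation.\<close>
      have "(b / (a \<bullet> y)) *\<^sub>R y \<in> C"
        using C(1) that neg \<open>b < 0\<close> unfolding ord_cone_def
        by (simp add: divide_nonpos_nonpos)
      from ab(2)[OF this] neg show False by simp
    qed
    then have "(\<bullet>) a \<in> dual_cone C"
      by (simp add: dual_cone_def bounded_linear.linear[OF bounded_linear_inner_right])
    with dual ab(1) \<open>b < 0\<close> show False by fastforce
  qed
qed (simp add: dual_cone_def)

text \<open>Both \<open>u\<close> and its negative pass the dual test for membership, and the cone
  is pointed.\<close>

lemma dual_cone_separates:
  fixes C :: "'a::euclidean_space set"
  assumes C: "ord_cone C" "closed C" and u: "\<And>f. f \<in> dual_cone C \<Longrightarrow> f u = 0"
  shows "u = 0"
proof (rule ord_cone_antisym[OF C(1)])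
  have "0 \<le> f u" "0 \<le> f (- u)" if "f \<in> dual_cone C" for f
    using u[OF that] that by (simp_all add: dual_cone_def linear_neg)
  then show "u \<in> C" "- u \<in> C"
    unfolding mem_ord_cone_iff_dual[OF C] by blast+
qed

text \<open>A vector orthogonal to the span is annihilated by every dual functional. The adjoint
  uses this as its generating set, as A uses the cone.\<close>

lemma span_dual_cone:
  fixes C :: "'a::euclidean_space set"
  assumes C: "ord_cone C" "closed C"
  shows "span {a. (\<bullet>) a \<in> dual_cone C} = UNIV"
proof (rule ccontr)
  assume "span {a. (\<bullet>) a \<in> dual_cone C} \<noteq> UNIV"
  from span_not_UNIV_orthogonal[OF this] obtain u where u: "u \<noteq> 0"
    and orth: "\<forall>a\<in>span {a. (\<bullet>) a \<in> dual_cone C}. u \<bullet> a = 0" by (elim exE conjE)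
  have "f u = 0" if "f \<in> dual_cone C" for f
  proof -
    \<comment> \<open>The vector representing \<open>f\<close> is the image of 1 under its
      adjoint.\<close>
    have "f y = adjoint f 1 \<bullet> y" for y
      using that adjoint_works[of f y 1] by (simp add: dual_cone_def inner_commute)
    then have f_eq: "f = (\<bullet>) (adjoint f 1)" by blast
    have "u \<bullet> adjoint f 1 = 0"
      by (rule orth[rule_format], rule span_base) (simp add: that f_eq[symmetric])
    then show ?thesis by (subst f_eq) (simp add: inner_commute)
  qed
  then have "u = 0" by (rule dual_cone_separates[OF C])
  with u show False by contradiction
qed

section \<open>Blow-up of resolvents and eigenvectors as limits\<close>

lemma nonpos_if_le_mult_all_small:
  fixes a K :: real
  assumes "\<And>e. 0 < e \<Longrightarrow> e < 1 \<Longrightarrow> a \<le> K * e"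
  shows "a \<le> 0"
proof (rule tendsto_lowerbound[where F = "at_right 0"])
  show "((\<lambda>e. K * e) \<longlongrightarrow> 0) (at_right 0)"
    by (auto intro!: tendsto_eq_intros)
  show "\<forall>\<^sub>F e in at_right 0. a \<le> K * e"
    using eventually_at_right_less[of 0] eventually_at_right_real[of 0 1] assms
    by (auto elim: eventually_mono)
qed simp

text \<open>Solutions for a sum or multiple are sums or multiples of solutions, and \<open>N\<close>
  is a seminorm. This extends uniform resolvent bounds from a generating set to the whole
  space.\<close>

lemma subspace_bounded_solutions:
  fixes T :: "'i \<Rightarrow> 'b::euclidean_space \<Rightarrow> 'b" and N :: "'b \<Rightarrow> real"
  assumes T: "\<And>c. c \<in> I \<Longrightarrow> linear (T c)" "\<And>c. c \<in> I \<Longrightarrow> inj (T c)"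
    and N: "\<And>x y. N (x + y) \<le> N x + N y" "\<And>r x. N (r *\<^sub>R x) = \<bar>r\<bar> * N x"
  shows "subspace {x. \<exists>K. \<forall>c\<in>I. \<forall>z. T c z = x \<longrightarrow> N z \<le> K}" (is "subspace ?S")
proof (rule subspaceI)
  have "N 0 = 0" using N(2)[of 0 0] by simp
  moreover have "z = 0" if "c \<in> I" "T c z = 0" for c z
    using that T linear_injective_0 by blast
  ultimately show "0 \<in> ?S" by fastforce
next
  fix x y assume "x \<in> ?S" "y \<in> ?S"
  then obtain K L where K: "\<And>c z. c \<in> I \<Longrightarrow> T c z = x \<Longrightarrow> N z \<le> K"
    and L: "\<And>c z. c \<in> I \<Longrightarrow> T c z = y \<Longrightarrow> N z \<le> L" by blast
  have "N z \<le> K + L" if c: "c \<in> I" and z: "T c z = x + y" for c z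
  proof -
    obtain p where p: "T c p = x"
      using linear_injective_imp_surjective[OF T[OF c]] by (metis surjE)
    then have "T c (z - p) = y" using z by (simp add: linear_diff[OF T(1)[OF c]])
    then show ?thesis using N(1)[of p "z - p"] K[OF c p] L[OF c] by fastforce
  qed
  then show "x + y \<in> ?S" by blast
next
  fix r :: real and x assume "x \<in> ?S"
  then obtain K where K: "\<And>c z. c \<in> I \<Longrightarrow> T c z = x \<Longrightarrow> N z \<le> K" by blast
  have "N z \<le> \<bar>r\<bar> * K" if c: "c \<in> I" and z: "T c z = r *\<^sub>R x" for c z
  proof -
    obtain p where p: "T c p = x"
      using linear_injective_imp_surjective[OF T[OF c]] by (metis surjE)
    then have "T c (r *\<^sub>R p) = T c z" using z by (simp add: linear_scale[OF T(1)[OF c]])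
    then have "z = r *\<^sub>R p" using T(2)[OF c] by (metis injD)
    then show ?thesis using K[OF c p] by (simp add: N(2) mult_left_mono)
  qed
  then show "r *\<^sub>R x \<in> ?S" by blast
qed

text \<open>Bounded resolvents on \<open>G\<close> would be bounded on its span, but the resolvent
  of \<open>v\<close> at c is v/(c - s). So they blow up for some \<open>x\<close> in
  \<open>G\<close>, and a limit of the normalised resolvents is an eigenvector. Normalising also
  sends a fixed lower bound -K to 0.\<close>

lemma resolvent_limit_eigenvector:
  fixes B :: "'b::euclidean_space \<Rightarrow> 'b"
  assumes B: "linear B" and v: "B v = s *\<^sub>R v" "v \<noteq> 0" and G: "span G = UNIV"
    and inj: "\<forall>c>s. \<forall>u. B u = c *\<^sub>R u \<longrightarrow> u = 0"
  shows "\<exists>x\<in>G. \<exists>y. y \<noteq> 0 \<and> B y = s *\<^sub>R y \<and>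
    (\<forall>(h :: 'b \<Rightarrow> real) K. linear h \<longrightarrow> (\<forall>c\<in>{s<..<s + 1}. \<forall>u. c *\<^sub>R u - B u = x \<longrightarrow> - K \<le> h u) \<longrightarrow> 0 \<le> h y)"
proof -
  let ?I = "{s<..<s + 1}"
  have lin: "linear (\<lambda>u. c *\<^sub>R u - B u)" for c
    by (intro linear_compose_sub B linear_scale_self)
  have injT: "inj (\<lambda>u. c *\<^sub>R u - B u)" if "c \<in> ?I" for c
    unfolding linear_injective_0[OF lin] using inj that by auto
  let ?S = "{x. \<exists>K. \<forall>c\<in>?I. \<forall>u. c *\<^sub>R u - B u = x \<longrightarrow> norm u \<le> K}"
  have "subspace ?S"
    by (rule subspace_bounded_solutions) (auto simp: lin injT norm_triangle_ineq)
  moreover have "v \<notin> ?S"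
  proof
    assume "v \<in> ?S"
    then obtain K where K: "\<And>c u. c \<in> ?I \<Longrightarrow> c *\<^sub>R u - B u = v \<Longrightarrow> norm u \<le> K" by blast
    have "norm v \<le> K * e" if "0 < e" "e < 1" for e
    proof -
      have "(s + e) *\<^sub>R ((1 / e) *\<^sub>R v) - B ((1 / e) *\<^sub>R v) = v"
        using that by (simp add: linear_scale[OF B] v(1) scaleR_diff_left[symmetric]
            diff_divide_distrib[symmetric])
      then have "norm ((1 / e) *\<^sub>R v) \<le> K" by (rule K[rotated]) (use that in simp)
      then show ?thesis using that by (simp add: field_simps)
    qed
    then have "norm v \<le> 0" by (rule nonpos_if_le_mult_all_small)
    with v(2) show False by simp
  qed
  ultimately have "\<not> G \<subseteq> ?S"
    using span_minimal[of G ?S] G by blast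
  then obtain x where x: "x \<in> G" "x \<notin> ?S" by blast
  have unbounded: "\<exists>c u. c \<in> ?I \<and> c *\<^sub>R u - B u = x \<and> K < norm u" for K
  proof (rule ccontr)
    assume "\<nexists>c u. c \<in> ?I \<and> c *\<^sub>R u - B u = x \<and> K < norm u"
    then have "\<forall>c\<in>?I. \<forall>u. c *\<^sub>R u - B u = x \<longrightarrow> norm u \<le> K" by (meson not_le)
    with x(2) show False by blast
  qed
  \<comment> \<open>The threshold \<open>Suc n\<close> keeps the norms positive and bounds their
    inverses by a null sequence.\<close>
  have "\<forall>n::nat. \<exists>c u. c \<in> ?I \<and> c *\<^sub>R u - B u = x \<and> real (Suc n) < norm u"
    by (intro allI unbounded)
  then obtain c u where cu: "\<And>n::nat. c n \<in> ?I" "\<And>n. c n *\<^sub>R u n - B (u n) = x"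
      "\<And>n. real (Suc n) < norm (u n)"
    by metis
  define w where "w n = (c n, u n /\<^sub>R norm (u n))" for n
  have upos: "norm (u n) > 0" for n using cu(3)[of n] by linarith
  have "compact ({s..s + 1} \<times> sphere (0 :: 'b) 1)" by (intro compact_Times) auto
  moreover have "w n \<in> {s..s + 1} \<times> sphere 0 1" for n
    using cu(1)[of n] upos[of n] by (auto simp: w_def)
  ultimately obtain l r where l: "l \<in> {s..s + 1} \<times> sphere 0 1" and r: "strict_mono r"
    and lim: "(w \<circ> r) \<longlonglongrightarrow> l"
    unfolding compact_def by metis
  obtain c0 y where cy: "l = (c0, y)" by fastforce
  have limc: "(\<lambda>n. c (r n)) \<longlonglongrightarrow> c0" and limy: "(\<lambda>n. u (r n) /\<^sub>R norm (u (r n))) \<longlonglongrightarrow> y"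
    using tendsto_fst[OF lim] tendsto_snd[OF lim] by (simp_all add: cy w_def o_def)
  have inv0: "(\<lambda>n. inverse (norm (u (r n)))) \<longlonglongrightarrow> 0"
  proof (rule Lim_null_comparison[OF _ LIMSEQ_subseq_LIMSEQ[OF LIMSEQ_inverse_real_of_nat r]])
    show "\<forall>\<^sub>F n in sequentially. norm (inverse (norm (u (r n))))
        \<le> ((\<lambda>n. inverse (real (Suc n))) \<circ> r) n"
      using less_imp_le[OF cu(3)]
      by (intro always_eventually allI) (auto intro!: le_imp_inverse_le simp del: of_nat_Suc)
  qed
  have "bounded_linear B" using B by (simp add: linear_conv_bounded_linear)
  have "(\<lambda>n. c (r n) *\<^sub>R (u (r n) /\<^sub>R norm (u (r n))) - B (u (r n) /\<^sub>R norm (u (r n))))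
      \<longlonglongrightarrow> c0 *\<^sub>R y - B y"
    by (intro tendsto_intros limc limy bounded_linear.tendsto[OF \<open>bounded_linear B\<close>])
  moreover have "c (r n) *\<^sub>R (u (r n) /\<^sub>R norm (u (r n))) - B (u (r n) /\<^sub>R norm (u (r n)))
      = inverse (norm (u (r n))) *\<^sub>R x" for n
    by (simp add: linear_scale[OF B] cu(2)[of "r n", symmetric] algebra_simps)
  moreover have "(\<lambda>n. inverse (norm (u (r n))) *\<^sub>R x) \<longlonglongrightarrow> 0 *\<^sub>R x"
    by (intro tendsto_intros inv0)
  ultimately have "c0 *\<^sub>R y - B y = 0"
    using LIMSEQ_unique by fastforce
  then have By: "B y = c0 *\<^sub>R y" by simp
  have "y \<noteq> 0" using l cy by auto
  \<comment> \<open>Convergence of the parameters to \<open>s\<close> was not arranged; it follows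
    because a limit above \<open>s\<close> would be an eigenvalue.\<close>
  with inj By l cy have "c0 = s" by (cases "s < c0") auto
  have nonneg: "0 \<le> h y" if h: "linear h" and K: "\<forall>c\<in>?I. \<forall>u. c *\<^sub>R u - B u = x \<longrightarrow> - K \<le> h u"
    for h :: "'b \<Rightarrow> real" and K
  proof (rule tendsto_le[OF sequentially_bot])
    have "bounded_linear h" using h by (simp add: linear_conv_bounded_linear)
    then show "(\<lambda>n. h (u (r n) /\<^sub>R norm (u (r n)))) \<longlonglongrightarrow> h y"
      by (rule bounded_linear.tendsto[OF _ limy])
    have "(\<lambda>n. inverse (norm (u (r n))) * (- K)) \<longlonglongrightarrow> 0 * (- K)"
      by (intro tendsto_intros inv0)
    then show "(\<lambda>n. inverse (norm (u (r n))) * (- K)) \<longlonglongrightarrow> 0" by simp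
    show "\<forall>\<^sub>F n in sequentially. inverse (norm (u (r n))) * (- K) \<le> h (u (r n) /\<^sub>R norm (u (r n)))"
    proof (intro always_eventually allI)
      fix n
      have "- K \<le> h (u (r n))" using K cu(1,2) by blast
      then show "inverse (norm (u (r n))) * (- K) \<le> h (u (r n) /\<^sub>R norm (u (r n)))"
        unfolding linear_scale[OF h] real_scaleR_def by (rule mult_left_mono) simp
    qed
  qed
  have "\<forall>(h :: 'b \<Rightarrow> real) K. linear h \<longrightarrow> (\<forall>c\<in>?I. \<forall>u. c *\<^sub>R u - B u = x \<longrightarrow> - K \<le> h u) \<longrightarrow> 0 \<le> h y"
    by (intro allI impI) (rule nonneg)
  with \<open>y \<noteq> 0\<close> By \<open>c0 = s\<close> show ?thesis
    by (intro bexI[OF _ x(1)] exI[of _ y] conjI) simp_all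
qed

section \<open>Resolvent estimates on the cone and the eigenvectors\<close>

text \<open>\<open>resolvent_domination\<close> is applied to the functionals reading off the real
  and imaginary parts of f(z), and the two estimates are added.\<close>

lemma resolvent_bound:
  fixes C :: "'a::euclidean_space set" and A :: "'a \<Rightarrow> 'a"
  assumes A: "linear A" and pos: "weakly_eventually_nonneg C A"
    and x: "x \<in> C" and f: "f \<in> dual_cone C"
  shows "\<exists>K. \<forall>c>spectral_bound A. \<forall>om z u. cmul (Complex c om) z - map_prod A A z = (x, 0) \<longrightarrow>
    c *\<^sub>R u - A u = x \<longrightarrow> \<bar>f (fst z)\<bar> + \<bar>f (snd z)\<bar> \<le> 2 * f u + K"
proof -
  let ?s = "spectral_bound A"
  have lf: "linear f" using f by (simp add: dual_cone_def)
  obtain t0 where t0: "t0 \<ge> 0" "\<And>t. t \<ge> t0 \<Longrightarrow> 0 \<le> f (op_exp t A x)"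
    using pos x f unfolding weakly_eventually_nonneg_def by blast
  have "bounded_linear f" using lf by (simp add: linear_conv_bounded_linear)
  moreover have "continuous_on {0..t0} (\<lambda>t. op_exp t A x)"
    by (intro continuous_at_imp_continuous_on ballI
        has_vector_derivative_continuous[OF op_exp_has_vector_derivative[OF A]])
  ultimately have "continuous_on {0..t0} (\<lambda>t. f (op_exp t A x))"
    by (rule bounded_linear.continuous_on)
  then have "continuous_on {0..t0} (\<lambda>t. exp (- (t * ?s)) * \<bar>f (op_exp t A x)\<bar>)"
    by (intro continuous_intros)
  \<comment> \<open>For t \<ge> 0 the weight is largest at the spectral bound, so this one bound
    serves every \<open>c\<close> above it.\<close>
  then have "bounded ((\<lambda>t. exp (- (t * ?s)) * \<bar>f (op_exp t A x)\<bar>) ` {0..t0})"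
    by (intro compact_imp_bounded compact_continuous_image) auto
  then obtain K where K: "\<And>t. 0 \<le> t \<Longrightarrow> t \<le> t0 \<Longrightarrow> exp (- (t * ?s)) * \<bar>f (op_exp t A x)\<bar> \<le> K"
    unfolding bounded_iff by fastforce
  have "\<bar>f (fst z)\<bar> + \<bar>f (snd z)\<bar> \<le> 2 * f u + 4 * K * t0"
    if c: "?s < c" and z: "cmul (Complex c om) z - map_prod A A z = (x, 0)"
      and u: "c *\<^sub>R u - A u = x" for c om z u
  proof -
    have Kc: "exp (- (t * c)) * \<bar>f (op_exp t A x)\<bar> \<le> K" if "0 \<le> t" "t \<le> t0" for t
    proof -
      have "exp (- (t * c)) \<le> exp (- (t * ?s))" using that c by (simp add: mult_left_mono)
      then show ?thesis using K[OF that] by (meson abs_ge_zero mult_right_mono order_trans)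
    qed
    have "\<bar>h z\<bar> \<le> f u + 2 * K * t0"
      if "linear h" "\<And>c v. \<bar>h (cmul c (v, 0))\<bar> \<le> cmod c * \<bar>f v\<bar>" for h
      by (rule resolvent_domination[OF A _ lf that t0 _ z]) (use c Kc u in auto)
    moreover have "linear (\<lambda>z. f (fst z))" "linear (\<lambda>z. f (snd z))"
      by (rule linearI; simp add: linear_add[OF lf] linear_scale[OF lf])+
    moreover have "\<bar>f (fst (cmul c (v, 0)))\<bar> \<le> cmod c * \<bar>f v\<bar>"
      "\<bar>f (snd (cmul c (v, 0)))\<bar> \<le> cmod c * \<bar>f v\<bar>" for c v
      by (simp_all add: cmul_def linear_scale[OF lf] abs_mult abs_Re_le_cmod abs_Im_le_cmod
          mult_right_mono)
    ultimately have "\<bar>f (fst z)\<bar> \<le> f u + 2 * K * t0" "\<bar>f (snd z)\<bar> \<le> f u + 2 * K * t0"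
      by blast+
    then show ?thesis by simp
  qed
  then show ?thesis by blast
qed

theorem theorem4p1:
  fixes C :: "'a::euclidean_space set" and A :: "'a \<Rightarrow> 'a"
  assumes "ord_cone C" and "closed C" and "interior C \<noteq> {}"
    and "linear A"
    and "weakly_eventually_nonneg C A"
  shows "complex_of_real (spectral_bound A) \<in> cspectrum A
         \<and> (\<exists>x. x \<noteq> 0 \<and> A x = spectral_bound A *\<^sub>R x)
         \<and> (\<exists>x\<in>C. x \<noteq> 0 \<and> A x = spectral_bound A *\<^sub>R x)
         \<and> (\<exists>f\<in>dual_cone C. f \<noteq> (\<lambda>_. 0) \<and> (\<forall>y. f (A y) = spectral_bound A * f y))"
proof -
  note C = assms(1,2) and A = assms(4) and pos = assms(5)
  let ?s = "spectral_bound A" and ?B = "map_prod A A"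
  \<comment> \<open>The interior point makes the cone generating.\<close>
  have spanC: "span C = UNIV"
    using affine_hull_nonempty_interior[OF assms(3)] affine_hull_subset_span[of C] by auto
  have real_eigen: "complex_of_real r \<in> cspectrum A" if "A v = r *\<^sub>R v" "v \<noteq> 0" for r v
    unfolding mem_cspectrum_iff[OF A]
    by (rule exI[of _ "(v, 0)"]) (use that linear_0[OF A] in \<open>auto simp: cmul_simps zero_prod_def\<close>)
  have injA: "u = 0" if "?s < c" "A u = c *\<^sub>R u" for c u
    using real_eigen[of u c] Re_le_spectral_bound[OF A, of c] that by fastforce
  have linA: "linear (\<lambda>u. c *\<^sub>R u - A u)" for c
    by (intro linear_compose_sub A linear_scale_self)
  have surjA: "\<exists>u. c *\<^sub>R u - A u = x" if "?s < c" for c x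
  proof -
    have "inj (\<lambda>u. c *\<^sub>R u - A u)"
      unfolding linear_injective_0[OF linA] using injA that by auto
    from linear_injective_imp_surjective[OF linA this] show ?thesis by (rule surjE[of _ x]) auto
  qed
  \<comment> \<open>Frequency 0 and z = (u, 0) in \<open>resolvent_bound\<close> give 0 \<le> 2 f(u)
    + K.\<close>
  have lower: "\<exists>K. \<forall>c>?s. \<forall>u. c *\<^sub>R u - A u = x \<longrightarrow> - K \<le> f u"
    if xf: "x \<in> C" "f \<in> dual_cone C" for x f
  proof -
    obtain K where K: "\<And>c om z u. ?s < c \<Longrightarrow> cmul (Complex c om) z - ?B z = (x, 0) \<Longrightarrow>
        c *\<^sub>R u - A u = x \<Longrightarrow> \<bar>f (fst z)\<bar> + \<bar>f (snd z)\<bar> \<le> 2 * f u + K"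
      using resolvent_bound[OF A pos xf] by blast
    have "- (K / 2) \<le> f u" if "?s < c" "c *\<^sub>R u - A u = x" for c u
      using K[OF that(1) _ that(2), of 0 "(u, 0)"] that(2)
      by (simp add: cmul_def linear_0[OF A])
    then show ?thesis by blast
  qed
  have "\<exists>v. v \<noteq> 0 \<and> A v = ?s *\<^sub>R v"
  proof (rule ccontr)
    assume none: "\<nexists>v. v \<noteq> 0 \<and> A v = ?s *\<^sub>R v"
    then have "inj (\<lambda>u. ?s *\<^sub>R u - A u)"
      unfolding linear_injective_0[OF linA] by auto
    then obtain d where d: "d > 0" "\<And>u. d * norm u \<le> norm (?s *\<^sub>R u - A u)"
      using linear_inj_bounded_below_pos[OF linA] by blast
    \<comment> \<open>Perturbing the lower bound at the spectral bound costs at most half of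
      \<open>d\<close>; real resolvents therefore stay bounded near it.\<close>
    have near: "d / 2 * norm u \<le> norm (c *\<^sub>R u - A u)" if "?s < c" "c < ?s + d / 2" for c u
    proof -
      have "norm (?s *\<^sub>R u - A u) \<le> norm (c *\<^sub>R u - A u) + norm ((c - ?s) *\<^sub>R u)"
        using norm_triangle_ineq4[of "c *\<^sub>R u - A u" "(c - ?s) *\<^sub>R u"] by (simp add: algebra_simps)
      moreover have "norm ((c - ?s) *\<^sub>R u) \<le> d / 2 * norm u"
        using that by (auto intro!: mult_right_mono simp del: times_divide_eq_left)
      ultimately show ?thesis using d(2)[of u] by simp
    qed
    obtain l where l: "l \<in> cspectrum A" "Re l = ?s"
      using spectral_bound_attained[OF A] by blast
    then obtain z0 where z0: "z0 \<noteq> 0" "?B z0 = cmul l z0"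
      using mem_cspectrum_iff[OF A] by blast
    let ?I = "{?s<..<?s + min 1 (d / 2)}"
    let ?T = "\<lambda>c z. cmul (Complex c (Im l)) z - ?B z"
    have linT: "linear (?T c)" for c
      by (intro linear_compose_sub linear_map_prod A cmul_linear)
    have injT: "inj (?T c)" if "c \<in> ?I" for c
    proof -
      have "Complex c (Im l) \<notin> cspectrum A"
        using Re_le_spectral_bound[OF A, of "Complex c (Im l)"] that by auto
      then show ?thesis
        unfolding linear_injective_0[OF linT] mem_cspectrum_iff[OF A] right_minus_eq
        by (metis (no_types))
    qed
    \<comment> \<open>As c + i Im l approaches l horizontally, \<open>f\<close> stays bounded on the
      resolvents of cone vectors, hence on those of all vectors. For the eigenvector
      \<open>z0\<close> these are z0/(c - s), so \<open>f\<close> must vanish on it.\<close>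
    have vanish: "f (fst z0) = 0 \<and> f (snd z0) = 0" if f: "f \<in> dual_cone C" for f
    proof -
      have lf: "linear f" using f by (simp add: dual_cone_def)
      define N where "N z = \<bar>f (fst z)\<bar> + \<bar>f (snd z)\<bar>" for z
      have N_scaleR: "N (r *\<^sub>R x) = \<bar>r\<bar> * N x" for r x
        by (simp add: N_def linear_scale[OF lf] abs_mult distrib_left)
      define S where "S = {w. \<exists>K. \<forall>c\<in>?I. \<forall>z. ?T c z = w \<longrightarrow> N z \<le> K}"
      have subS: "subspace S"
        unfolding S_def
      proof (rule subspace_bounded_solutions)
        show "N (x + y) \<le> N x + N y" for x y
          by (simp add: N_def linear_add[OF lf])
      qed (simp_all add: linT injT N_scaleR)
      have real_in: "(x, 0) \<in> S" if x: "x \<in> C" for x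
      proof -
        obtain K where K: "\<And>c om z u. ?s < c \<Longrightarrow> cmul (Complex c om) z - ?B z = (x, 0) \<Longrightarrow>
            c *\<^sub>R u - A u = x \<Longrightarrow> N z \<le> 2 * f u + K"
          using resolvent_bound[OF A pos x f] unfolding N_def by blast
        obtain M where M: "M > 0" "\<And>u. \<bar>f u\<bar> \<le> norm u * M"
          using bounded_linear.pos_bounded[of f] lf by (auto simp: linear_conv_bounded_linear)
        have "N z \<le> 2 * (2 * norm x / d * M) + K" if c: "c \<in> ?I" and z: "?T c z = (x, 0)" for c z
        proof -
          obtain u where u: "c *\<^sub>R u - A u = x" using surjA[of c x] c by auto
          have "c < ?s + d / 2" using c min.cobounded2[of 1 "d / 2"] by simp
          then have "norm u \<le> 2 * norm x / d"
            using near[of c u] c u d(1) by (simp add: field_simps)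
          then have "f u \<le> 2 * norm x / d * M"
            using M(2)[of u] M(1) by (smt (verit) mult_right_mono)
          then show ?thesis using K[OF _ z u] c by simp
        qed
        then show ?thesis unfolding S_def by blast
      qed
      have imag_in: "(0, x) \<in> S" if "x \<in> C" for x
      proof -
        obtain K where K: "\<And>c z. c \<in> ?I \<Longrightarrow> ?T c z = (x, 0) \<Longrightarrow> N z \<le> K"
          using real_in[OF \<open>x \<in> C\<close>] unfolding S_def by blast
        have "N z \<le> K" if "c \<in> ?I" "?T c z = (0, x)" for c z
        proof -
          \<comment> \<open>Multiplication by -i makes an imaginary right-hand side real and, up to
            sign, swaps the two parts, which leaves \<open>N\<close> unchanged.\<close>
          have "?T c (cmul (- \<i>) z) = cmul (- \<i>) (?T c z)"
            by (simp add: map_prod_cmul[OF A] cmul_add(4) cmul_simps mult.commute)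
          also have "\<dots> = (x, 0)" unfolding that(2) by (simp add: cmul_def)
          finally have "N (cmul (- \<i>) z) \<le> K" using K that(1) by blast
          then show ?thesis by (simp add: N_def cmul_def linear_neg[OF lf])
        qed
        then show ?thesis unfolding S_def by blast
      qed
      have "(u, 0) \<in> S \<and> (0, u) \<in> S" for u
      proof -
        have "u \<in> span C" using spanC by simp
        then show ?thesis
        proof (induction rule: span_induct_alt)
          case base
          then show ?case using subspace_0[OF subS] by (simp add: zero_prod_def)
        next
          case (step c x y)
          have "c *\<^sub>R (x, 0) + (y, 0) \<in> S" "c *\<^sub>R (0, x) + (0, y) \<in> S"
            using step real_in[of x] imag_in[of x]
            by (auto intro!: subspace_add[OF subS] subspace_mul[OF subS] simp del: scaleR_Pair add_Pair)
          then show ?case by simp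
        qed
      qed
      then have "(fst z0, 0) + (0, snd z0) \<in> S" using subspace_add[OF subS] by blast
      then have "z0 \<in> S" by simp
      then obtain K where K: "\<And>c z. c \<in> ?I \<Longrightarrow> ?T c z = z0 \<Longrightarrow> N z \<le> K"
        unfolding S_def by blast
      let ?m = "min 1 (d / 2)"
      have "N z0 \<le> (K * ?m) * e" if e: "0 < e" "e < 1" for e
      proof -
        have m: "0 < ?m * e" "?m * e < ?m" using e d(1) by (auto simp: min_def)
        have "Complex (?s + ?m * e) (Im l) = l + of_real (?m * e)"
          using l(2) by (simp add: complex_eq_iff)
        \<comment> \<open>The spectral parameter differs from \<open>l\<close> by the real number m
          e, and \<open>z0\<close> is an eigenvector for \<open>l\<close>.\<close>
        then have "?T (?s + ?m * e) ((1 / (?m * e)) *\<^sub>R z0) = z0"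
          using m(1) e(1) d(1)
          by (simp add: min_def linear_scale[OF linear_map_prod[OF A]] linear_scale[OF cmul_linear]
              z0(2) cmul_add cmul_simps scaleR_diff_right[symmetric] del: of_real_mult)
        then have "N ((1 / (?m * e)) *\<^sub>R z0) \<le> K" by (rule K[rotated]) (use m in auto)
        moreover have "N ((1 / (?m * e)) *\<^sub>R z0) = N z0 / (?m * e)"
          using abs_of_pos[of "1 / (?m * e)"] m(1) unfolding N_scaleR by simp
        ultimately show ?thesis using pos_divide_le_eq[OF m(1)] by (simp add: mult.assoc)
      qed
      then have "N z0 \<le> 0" by (rule nonpos_if_le_mult_all_small)
      then show ?thesis unfolding N_def by linarith
    qed
    have "fst z0 = 0" "snd z0 = 0"
      using vanish by (auto intro: dual_cone_separates[OF C])
    then have "z0 = 0" by (simp add: prod_eq_iff)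
    with z0(1) show False by simp
  qed
  then obtain v where v: "v \<noteq> 0" "A v = ?s *\<^sub>R v" by blast
  have b: "\<exists>x\<in>C. x \<noteq> 0 \<and> A x = ?s *\<^sub>R x"
  proof -
    have "\<forall>c>?s. \<forall>u. A u = c *\<^sub>R u \<longrightarrow> u = 0" using injA by blast
    from resolvent_limit_eigenvector[OF A v(2,1) spanC this]
    obtain x y where x: "x \<in> C" and y: "y \<noteq> 0" "A y = ?s *\<^sub>R y"
      and lim: "\<forall>(h :: 'a \<Rightarrow> real) K. linear h \<longrightarrow>
        (\<forall>c\<in>{?s<..<?s + 1}. \<forall>u. c *\<^sub>R u - A u = x \<longrightarrow> - K \<le> h u) \<longrightarrow> 0 \<le> h y"
      by (elim bexE exE conjE)
    have "0 \<le> f y" if f: "f \<in> dual_cone C" for f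
    proof -
      obtain K where K: "\<forall>c>?s. \<forall>u. c *\<^sub>R u - A u = x \<longrightarrow> - K \<le> f u" using lower[OF x f] by blast
      show ?thesis
        by (rule lim[THEN spec, THEN spec[of _ K], THEN mp, THEN mp])
          (use f K in \<open>auto simp: dual_cone_def\<close>)
    qed
    then have "y \<in> C" using mem_ord_cone_iff_dual[OF C] by blast
    with y show ?thesis by blast
  qed
  have c: "\<exists>f\<in>dual_cone C. f \<noteq> (\<lambda>_. 0) \<and> (\<forall>y. f (A y) = ?s * f y)"
  proof -
    let ?A' = "adjoint A"
    have A': "linear ?A'" using adjoint_linear[OF A] .
    have adj: "?A' a \<bullet> x = a \<bullet> A x" for a x
      using adjoint_works[OF A, of x a] by (simp add: inner_commute)
    \<comment> \<open>A singular operator misses part of the space; a vector orthogonal to its range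
      is an eigenvector of the adjoint.\<close>
    have "\<not> inj (\<lambda>u. ?s *\<^sub>R u - A u)"
      unfolding linear_injective_0[OF linA] using v by (auto intro!: exI[of _ v])
    then have "range (\<lambda>u. ?s *\<^sub>R u - A u) \<noteq> UNIV"
      using linear_surjective_imp_injective[OF linA] by blast
    then have "span (range (\<lambda>u. ?s *\<^sub>R u - A u)) \<noteq> UNIV"
      using span_eq_iff linear_subspace_image[OF linA subspace_UNIV] by metis
    from span_not_UNIV_orthogonal[OF this] obtain w where w0: "w \<noteq> 0"
      and orth: "\<forall>x\<in>span (range (\<lambda>u. ?s *\<^sub>R u - A u)). w \<bullet> x = 0" by (elim exE conjE)
    have w_orth: "w \<bullet> (?s *\<^sub>R u - A u) = 0" for u
      by (rule bspec[OF orth], rule span_base, rule rangeI)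
    have w_eig: "?A' w = ?s *\<^sub>R w"
    proof (rule vector_eq_ldot[THEN iffD1, rule_format])
      show "x \<bullet> ?A' w = x \<bullet> (?s *\<^sub>R w)" for x
        using w_orth[of x] adj[of w x] by (simp add: inner_diff_right inner_commute)
    qed
    have "a = 0" if c: "?s < c" and a: "?A' a = c *\<^sub>R a" for c a
    proof -
      obtain u where u: "c *\<^sub>R u - A u = a" using surjA[OF c] by blast
      \<comment> \<open>Writing one copy of \<open>a\<close> as (c - A) u and moving the operator
        across leaves 0.\<close>
      have "a \<bullet> a = (c *\<^sub>R a - ?A' a) \<bullet> u"
        by (subst (2) u[symmetric]) (simp add: inner_diff_left inner_diff_right adj)
      with a show ?thesis by simp
    qed
    then have "\<forall>c>?s. \<forall>a. ?A' a = c *\<^sub>R a \<longrightarrow> a = 0" by blast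
    from resolvent_limit_eigenvector[OF A' w_eig w0 span_dual_cone[OF C] this]
    obtain a b where a: "(\<bullet>) a \<in> dual_cone C" and b: "b \<noteq> 0" "?A' b = ?s *\<^sub>R b"
      and lim: "\<forall>(h :: 'a \<Rightarrow> real) K. linear h \<longrightarrow>
        (\<forall>c\<in>{?s<..<?s + 1}. \<forall>u. c *\<^sub>R u - ?A' u = a \<longrightarrow> - K \<le> h u) \<longrightarrow> 0 \<le> h b"
      by (elim bexE exE conjE CollectE)
    have "0 \<le> b \<bullet> x" if x: "x \<in> C" for x
    proof -
      obtain K where K: "\<And>c u. ?s < c \<Longrightarrow> c *\<^sub>R u - A u = x \<Longrightarrow> - K \<le> a \<bullet> u"
        using lower[OF x a] by blast
      show ?thesis
      proof (rule lim[THEN spec[of _ "\<lambda>b. b \<bullet> x"], THEN spec[of _ K], THEN mp, THEN mp])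
        show "linear (\<lambda>b. b \<bullet> x)" by (rule bounded_linear.linear[OF bounded_linear_inner_left])
        show "\<forall>c\<in>{?s<..<?s + 1}. \<forall>u. c *\<^sub>R u - ?A' u = a \<longrightarrow> - K \<le> u \<bullet> x"
        proof (intro ballI allI impI)
          fix c p assume c: "c \<in> {?s<..<?s + 1}" and p: "c *\<^sub>R p - ?A' p = a"
          obtain u where u: "c *\<^sub>R u - A u = x" using surjA c by force
          \<comment> \<open>The resolvent of the adjoint is the adjoint of the resolvent, so the
            lower bound found for A carries over.\<close>
          have "p \<bullet> x = a \<bullet> u"
            unfolding u[symmetric] p[symmetric] by (simp add: inner_diff_left inner_diff_right adj)
          then show "- K \<le> p \<bullet> x" using K[OF _ u] c by simp
        qed
      qed
    qed
    then have "(\<bullet>) b \<in> dual_cone C"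
      by (simp add: dual_cone_def bounded_linear.linear[OF bounded_linear_inner_right])
    moreover have "(\<bullet>) b \<noteq> (\<lambda>_. 0)" using b(1) by (metis inner_eq_zero_iff)
    moreover have "b \<bullet> A y = ?s * (b \<bullet> y)" for y
      using adj[of b y] b(2) by simp
    ultimately show ?thesis by blast
  qed
  from real_eigen[OF v(2,1)] b c show ?thesis by blast
qed

end
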